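(* Let $l\ge0$, $\lambda\ge1$, $j\ge0$, $|m|\le l$, $|\mu|\le\lambda$, $q,m_1\in\{-1,0,1\}$ be integers and let $\alpha$ be the (real) quasi-periodicity parameter. For $n\in\mathbb Z\setminus\{0\}$ put $\mathbf b=(-n,0,0)$. Denote the series $\sum_{n\ne0}L_{l,j,\lambda}^{m,\mu,q,m_1}(\mathbf b)e^{-in\alpha}$ by $\mathscr L_{l,j,\lambda}^{m,\mu,q,m_1}(\alpha)$. Then $\mathscr L_{l,j,\lambda}^{m,\mu,q,m_1}(\alpha)$ equals $$i(-1)^{\lambda+\mu+q}\,\mathrm{sgn}(q-m_1)\,\epsilon_q\sqrt{\lambda(2l+1)}\sqrt{\binom{l+\lambda+\mu-m}{\lambda+\mu}\binom{l+\lambda+m-\mu}{\lambda-\mu}}\,\langle\lambda-1,\mu-m_1;1,m_1\mid\lambda,\mu\rangle\,\langle\lambda-1,\mu-m_1;1,q+m_1\mid j,\mu+q\rangle$$ $$\times\sqrt{\frac{4\pi}{2(l+\lambda)+1}}\Big(\mathrm{Li}_{l+\lambda}(e^{-i\alpha})Y_{l+\lambda}^{m-\mu}(\tfrac\pi2,\pi)-\mathrm{Li}_{l+\lambda}(e^{i\alpha})Y_{l+\lambda}^{m-\mu}(\tfrac\pi2,0)\Big),$$ where $\epsilon_{-1}=\frac1{\sqrt2}$, $\epsilon_0=0$, $\epsilon_1=-\frac1{\sqrt2}$.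
   Context: $Y_l^m(\theta,\phi)$ are the $L^2$-orthonormal complex spherical harmonics with Condon–Shortley phase ($\theta$ polar, $\phi$ azimuthal angle). $I_l^m(\mathbf r)=\sqrt{\frac{4\pi}{2l+1}}Y_l^m(\hat{\mathbf r})|\mathbf r|^{-l-1}$, $\hat{\mathbf r}=\mathbf r/|\mathbf r|$. $\langle j_1,m_1;j_2,m_2\mid j,m\rangle$ are the standard (Condon–Shortley) Clebsch–Gordan coefficients, $0$ for inadmissible indices; $\mathrm{sgn}(0)=0$. For $\mathbf b=(b_x,b_y,b_z)$, $b_{-q}=\frac1{\sqrt2}(b_x-ib_y)$ if $q=1$, $b_z$ if $q=0$, $-\frac1{\sqrt2}(b_x+ib_y)$ if $q=-1$. $$L_{l,j,\lambda}^{m,\mu,q,m_1}(\mathbf b)=i(-1)^{\lambda+\mu+q}\mathrm{sgn}(q-m_1)\,b_{-q}\sqrt{\lambda(2l+1)}\,I_{l+\lambda}^{m-\mu}(\mathbf b)\sqrt{\tbinom{l+\lambda+\mu-m}{\lambda+\mu}\tbinom{l+\lambda+m-\mu}{\lambda-\mu}}\langle\lambda-1,\mu-m_1;1,m_1\mid\lambda,\mu\rangle\langle\lambda-1,\mu-m_1;1,q+m_1\mid j,\mu+q\rangle.$$ The polylogarithm is defined by the series $\mathrm{Li}_s(z)=\sum_{k=1}^\infty z^k/k^s$.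
   Formalization: The case l = 0, λ = 1, α ∈ 2πℤ is excluded: there the right-hand side contains Li_1(1), the divergent harmonic series, and is undefined. *)

theory Defs
  imports "HOL-Analysis.Analysis" "HOL-Computational_Algebra.Polynomial"
begin

text \<open>Rodrigues' formula for the Legendre polynomials.\<close>

definition legendre :: "nat \<Rightarrow> real poly" where
  "legendre l = smult (1 / (2 ^ l * fact l)) ((pderiv ^^ l) ([:-1, 0, 1:] ^ l))"

text \<open>The factor \<open>(-1) ^ m\<close> is the Condon--Shortley phase.\<close>

definition assoc_legendre :: "nat \<Rightarrow> nat \<Rightarrow> real \<Rightarrow> real" where
  "assoc_legendre l m x =
     (-1) ^ m * sqrt (1 - x\<^sup>2) ^ m * poly ((pderiv ^^ m) (legendre l)) x"

definition sph_harm_nonneg :: "nat \<Rightarrow> nat \<Rightarrow> real \<Rightarrow> real \<Rightarrow> complex" where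
  "sph_harm_nonneg l m \<theta> \<phi> =
     of_real (sqrt ((2 * real l + 1) / (4 * pi) * (fact (l - m) / fact (l + m)))
              * assoc_legendre l m (cos \<theta>)) * exp (\<i> * of_nat m * of_real \<phi>)"

text \<open>\<open>\<theta>\<close> is the polar and \<open>\<phi>\<close> the azimuthal angle. Negative orders are given by
  \<open>Y l (-m) = (-1) ^ m * cnj (Y l m)\<close>. The value is \<open>0\<close> for \<open>\<bar>m\<bar> > l\<close>, because the
  derivative in \<^const>\<open>assoc_legendre\<close> vanishes.\<close>

definition sph_harm :: "nat \<Rightarrow> int \<Rightarrow> real \<Rightarrow> real \<Rightarrow> complex" where
  "sph_harm l m \<theta> \<phi> =
     (if 0 \<le> m then sph_harm_nonneg l (nat m) \<theta> \<phi>
      else (-1) ^ nat (- m) * cnj (sph_harm_nonneg l (nat (- m)) \<theta> \<phi>))"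

text \<open>Spherical harmonics on nonzero vectors, through the direction \<open>r / norm r\<close>. On the
  \<open>z\<close>-axis \<open>Arg 0 = 0\<close> is an arbitrary but harmless choice of azimuth: there the harmonics of
  nonzero order vanish and those of order zero do not depend on the azimuth.\<close>

definition sph_harm_dir :: "nat \<Rightarrow> int \<Rightarrow> real^3 \<Rightarrow> complex" where
  "sph_harm_dir l m r =
     (let u = r /\<^sub>R norm r in sph_harm l m (arccos (u $ 3)) (Arg (Complex (u $ 1) (u $ 2))))"

definition irregular_solid_harm :: "nat \<Rightarrow> int \<Rightarrow> real^3 \<Rightarrow> complex" where
  "irregular_solid_harm l m r =
     of_real (sqrt (4 * pi / (2 * real l + 1))) * sph_harm_dir l m r / of_real (norm r ^ (l + 1))"

definition int_fact :: "int \<Rightarrow> real" where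
  "int_fact n = fact (nat n)"

text \<open>Clebsch--Gordan coefficient
  \<open>\<langle>j\<^sub>1, m\<^sub>1; j\<^sub>2, m\<^sub>2 | J, M\<rangle>\<close> for integral angular momenta, by Racah's explicit
  formula; this has the Condon--Shortley phases. The sum ranges over all integers \<open>k\<close> for
  which no factorial has a negative argument.\<close>

definition clebsch_gordan :: "nat \<Rightarrow> int \<Rightarrow> nat \<Rightarrow> int \<Rightarrow> nat \<Rightarrow> int \<Rightarrow> real" where
  "clebsch_gordan j1' m1 j2' m2 J' M =
     (let j1 = int j1'; j2 = int j2'; J = int J' in
      if \<bar>m1\<bar> \<le> j1 \<and> \<bar>m2\<bar> \<le> j2 \<and> \<bar>M\<bar> \<le> J \<and> M = m1 + m2 \<and> \<bar>j1 - j2\<bar> \<le> J \<and> J \<le> j1 + j2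
      then
        sqrt (of_int (2 * J + 1) * int_fact (J + j1 - j2) * int_fact (J - j1 + j2)
              * int_fact (j1 + j2 - J) / int_fact (j1 + j2 + J + 1))
        * sqrt (int_fact (J + M) * int_fact (J - M) * int_fact (j1 - m1) * int_fact (j1 + m1)
                * int_fact (j2 - m2) * int_fact (j2 + m2))
        * (\<Sum>k \<in> {k. 0 \<le> k \<and> k \<le> j1 + j2 - J \<and> k \<le> j1 - m1 \<and> k \<le> j2 + m2
                     \<and> 0 \<le> J - j2 + m1 + k \<and> 0 \<le> J - j1 - m2 + k}.
             (-1) ^ nat k
             / (int_fact k * int_fact (j1 + j2 - J - k) * int_fact (j1 - m1 - k)
                * int_fact (j2 + m2 - k) * int_fact (J - j2 + m1 + k)
                * int_fact (J - j1 - m2 + k)))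
      else 0)"

text \<open>\<open>sph_comp b p\<close> is the spherical component \<open>b\<^sub>p\<close>.\<close>

definition sph_comp :: "real^3 \<Rightarrow> int \<Rightarrow> complex" where
  "sph_comp b p =
     (if p = -1 then (of_real (b $ 1) - \<i> * of_real (b $ 2)) / of_real (sqrt 2)
      else if p = 0 then of_real (b $ 3)
      else if p = 1 then - ((of_real (b $ 1) + \<i> * of_real (b $ 2)) / of_real (sqrt 2))
      else 0)"

definition int_binom :: "int \<Rightarrow> int \<Rightarrow> real" where
  "int_binom n k = real (nat n choose nat k)"

definition L_coeff ::
  "nat \<Rightarrow> nat \<Rightarrow> nat \<Rightarrow> int \<Rightarrow> int \<Rightarrow> int \<Rightarrow> int \<Rightarrow> real^3 \<Rightarrow> complex" where
  "L_coeff l j lam m \<mu> q m1 b =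
     \<i> * (-1) powi (int lam + \<mu> + q) * of_int (sgn (q - m1)) * sph_comp b (- q)
     * of_real (sqrt (real lam * (2 * real l + 1)))
     * irregular_solid_harm (l + lam) (m - \<mu>) b
     * of_real (sqrt (int_binom (int l + int lam + \<mu> - m) (int lam + \<mu>)
                      * int_binom (int l + int lam + m - \<mu>) (int lam - \<mu>)))
     * of_real (clebsch_gordan (lam - 1) (\<mu> - m1) 1 m1 lam \<mu>)
     * of_real (clebsch_gordan (lam - 1) (\<mu> - m1) 1 (q + m1) j (\<mu> + q))"

text \<open>Convergence of a series over the nonzero integers: both ends of the range of summation
  tend to infinity, independently of each other. Unconditional summability would be too strong,
  since the series below converges only conditionally for \<open>l = 0\<close>, \<open>lam = 1\<close>.\<close>

definition nonzero_int_sums :: "(int \<Rightarrow> complex) \<Rightarrow> complex \<Rightarrow> bool" where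
  "nonzero_int_sums f s \<longleftrightarrow>
     ((\<lambda>(M, N). \<Sum>n \<in> {- int M..int N} - {0}. f n) \<longlongrightarrow> s) (sequentially \<times>\<^sub>F sequentially)"

definition nonzero_int_suminf :: "(int \<Rightarrow> complex) \<Rightarrow> complex" where
  "nonzero_int_suminf f = (THE s. nonzero_int_sums f s)"

definition L_term ::
  "nat \<Rightarrow> nat \<Rightarrow> nat \<Rightarrow> int \<Rightarrow> int \<Rightarrow> int \<Rightarrow> int \<Rightarrow> real \<Rightarrow> int \<Rightarrow> complex" where
  "L_term l j lam m \<mu> q m1 \<alpha> n =
     L_coeff l j lam m \<mu> q m1 (vector [- of_int n, 0, 0])
     * exp (- (\<i> * of_int n * of_real \<alpha>))"

definition L_series ::
  "nat \<Rightarrow> nat \<Rightarrow> nat \<Rightarrow> int \<Rightarrow> int \<Rightarrow> int \<Rightarrow> int \<Rightarrow> real \<Rightarrow> complex" where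
  "L_series l j lam m \<mu> q m1 \<alpha> = nonzero_int_suminf (L_term l j lam m \<mu> q m1 \<alpha>)"

definition polylog :: "nat \<Rightarrow> complex \<Rightarrow> complex" where
  "polylog s z = (\<Sum>k. z ^ Suc k / of_nat (Suc k) ^ s)"

definition eps :: "int \<Rightarrow> real" where
  "eps q = (if q = -1 then 1 / sqrt 2 else if q = 1 then - 1 / sqrt 2 else 0)"

end

theory Submission imports Defs begin

text \<open>
  On the axis through the lattice points the vector \<open>(-n, 0, 0)\<close> has polar angle \<open>\<pi>/2\<close>, and
  its azimuth is \<open>\<pi>\<close> for \<open>n > 0\<close> and \<open>0\<close> for \<open>n < 0\<close>. So the angular factor takes only two
  values, and the dependence on \<open>n\<close> that remains is a power times a phase: the
  spherical component is \<open>n * eps q\<close> and the irregular harmonic of degree \<open>s = l + lam\<close>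
  contributes \<open>1 / \<bar>n\<bar> ^ (s + 1)\<close>. Together they give \<open>sgn n / \<bar>n\<bar> ^ s\<close>. Hence the positive half of
  the series is a constant times the polylogarithm series at \<open>exp (- \<i> \<alpha>)\<close>, the negative half is
  minus a constant times the one at \<open>exp (\<i> \<alpha>)\<close> (lemmas \<open>L_term_pos\<close> and \<open>L_term_neg\<close>).

  What is left is convergence on the unit circle (\<open>polylog_sums\<close>). For \<open>s \<ge> 2\<close> the
  polylogarithm series converges absolutely; for \<open>s = 1\<close> it converges away from the point \<open>1\<close> by
  Dirichlet's test (\<open>summable_power_decseq\<close>). The two ends of the bilateral sum are independent,
  so convergence of the two halves is what convergence in the product filter asks for
  (\<open>nonzero_int_sums_halves\<close>).
\<close>

section \<open>Polylogarithm series on the unit circle\<close>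

text \<open>Dirichlet's test for powers. Summation by parts collapses here to the identity
  \<open>z ^ k * a k - z ^ Suc k * a (Suc k) = (1 - z) * (z ^ k * a k) + z ^ Suc k * (a k - a (Suc k))\<close>:
  the left side telescopes, and the last term is dominated by a telescoping series of nonnegative
  reals.\<close>

lemma summable_power_decseq:
  fixes a :: "nat \<Rightarrow> real" and z :: complex
  assumes a: "decseq a" "a \<longlonglongrightarrow> 0" and z: "norm z \<le> 1" "z \<noteq> 1"
  shows "summable (\<lambda>k. z ^ k * of_real (a k))"
proof -
  define g where "g k = z ^ k * of_real (a k)" for k
  have pow: "norm (z ^ k) \<le> 1" for k
    using z(1) by (simp add: norm_power power_le_one)
  have "g \<longlonglongrightarrow> 0"
  proof (rule Lim_null_comparison)
    show "\<forall>\<^sub>F k in sequentially. norm (g k) \<le> \<bar>a k\<bar>"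
      using pow by (intro always_eventually) (simp add: g_def norm_mult mult_left_le_one_le)
    show "(\<lambda>k. \<bar>a k\<bar>) \<longlonglongrightarrow> 0"
      using a(2) by (rule tendsto_rabs_zero)
  qed
  then have "summable (\<lambda>k. g k - g (Suc k))"
    by (rule telescope_summable')
  moreover have "summable (\<lambda>k. z ^ Suc k * of_real (a k - a (Suc k)))"
  proof (rule summable_comparison_test'[OF telescope_summable'[OF a(2)]])
    fix k
    have "a (Suc k) \<le> a k"
      using a(1) by (simp add: decseq_Suc_iff)
    then show "norm (z ^ Suc k * of_real (a k - a (Suc k))) \<le> a k - a (Suc k)"
      using pow[of "Suc k"]
      by (simp only: norm_mult norm_of_real) (simp add: mult_left_le_one_le del: power_Suc)
  qed
  ultimately have "summable (\<lambda>k. (g k - g (Suc k)) - z ^ Suc k * of_real (a k - a (Suc k)))"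
    by (rule summable_diff)
  also have "(\<lambda>k. (g k - g (Suc k)) - z ^ Suc k * of_real (a k - a (Suc k))) = (\<lambda>k. (1 - z) * g k)"
    by (simp add: g_def algebra_simps)
  finally have "summable (\<lambda>k. inverse (1 - z) * ((1 - z) * g k))"
    by (rule summable_mult)
  then show ?thesis
    using z(2) by (simp add: g_def flip: mult.assoc)
qed

lemma polylog_sums:
  assumes "norm z \<le> 1" "s \<ge> 1" "s = 1 \<Longrightarrow> z \<noteq> 1"
  shows "(\<lambda>k. z ^ Suc k / of_nat (Suc k) ^ s) sums polylog s z"
proof -
  have "summable (\<lambda>k. z ^ Suc k / of_nat (Suc k) ^ s)"
  proof (cases "s = 1")
    case True
    have "summable (\<lambda>k. z ^ k * of_real (inverse (real (Suc k))))"
      using assms True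
      by (intro summable_power_decseq LIMSEQ_inverse_real_of_nat)
        (auto simp: decseq_def field_simps)
    then have "summable (\<lambda>k. z * (z ^ k * of_real (inverse (real (Suc k)))))"
      by (rule summable_mult)
    also have "(\<lambda>k. z * (z ^ k * of_real (inverse (real (Suc k))))) = (\<lambda>k. z ^ Suc k / of_nat (Suc k) ^ s)"
      using True by (simp add: divide_inverse mult.assoc del: of_nat_Suc)
    finally show ?thesis .
  next
    case False
    then have "summable (\<lambda>k. inverse (real k ^ s))"
      using inverse_power_summable[of s, where ?'a = real] assms(2) by simp
    then have "summable (\<lambda>k. inverse (real (Suc k) ^ s))"
      by (subst summable_Suc_iff)
    then show ?thesis
    proof (rule summable_comparison_test')
      fix k
      have "norm (z ^ Suc k) \<le> 1"
        using assms(1) by (simp only: norm_power power_le_one norm_ge_zero)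
      then show "norm (z ^ Suc k / of_nat (Suc k) ^ s) \<le> inverse (real (Suc k) ^ s)"
        by (simp only: norm_divide norm_power[of "of_nat _"] norm_of_nat)
          (simp add: divide_inverse mult_left_le_one_le del: power_Suc of_nat_Suc)
    qed
  qed
  then show ?thesis
    unfolding polylog_def by (rule summable_sums)
qed

section \<open>Series over the nonzero integers\<close>

lemma sum_nonzero_int_interval:
  fixes f :: "int \<Rightarrow> 'a::comm_monoid_add"
  shows "(\<Sum>n \<in> {- int M..int N} - {0}. f n)
    = (\<Sum>k<N. f (int (Suc k))) + (\<Sum>k<M. f (- int (Suc k)))"
proof -
  have "{- int M..int N} - {0} = (\<lambda>k. int (Suc k)) ` {..<N} \<union> (\<lambda>k. - int (Suc k)) ` {..<M}"
  proof (intro equalityI subsetI)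
    fix n assume n: "n \<in> {- int M..int N} - {0}"
    show "n \<in> (\<lambda>k. int (Suc k)) ` {..<N} \<union> (\<lambda>k. - int (Suc k)) ` {..<M}"
    proof (cases "n > 0")
      case True
      then show ?thesis
        using n by (intro UnI1 image_eqI[of _ _ "nat (n - 1)"]) auto
    next
      case False
      then show ?thesis
        using n by (intro UnI2 image_eqI[of _ _ "nat (- n - 1)"]) auto
    qed
  qed auto
  then have "(\<Sum>n \<in> {- int M..int N} - {0}. f n)
    = sum f ((\<lambda>k. int (Suc k)) ` {..<N}) + sum f ((\<lambda>k. - int (Suc k)) ` {..<M})"
    by (simp only:) (rule sum.union_disjoint; auto)
  then show ?thesis
    by (simp add: sum.reindex inj_on_def)
qed

lemma nonzero_int_sums_halves:
  assumes pos: "(\<lambda>k. f (int (Suc k))) sums a" and neg: "(\<lambda>k. f (- int (Suc k))) sums b"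
  shows "nonzero_int_sums f (a + b)"
proof -
  have "((\<lambda>p. (\<Sum>k<snd p. f (int (Suc k))) + (\<Sum>k<fst p. f (- int (Suc k)))) \<longlongrightarrow> a + b)
    (sequentially \<times>\<^sub>F sequentially)"
    by (intro tendsto_add filterlim_compose[OF pos[unfolded sums_def] filterlim_snd]
        filterlim_compose[OF neg[unfolded sums_def] filterlim_fst])
  then show ?thesis
    unfolding nonzero_int_sums_def by (simp only: sum_nonzero_int_interval case_prod_unfold)
qed

lemma nonzero_int_suminf_eqI:
  assumes "nonzero_int_sums f s"
  shows "nonzero_int_suminf f = s"
  unfolding nonzero_int_suminf_def
proof (rule the_equality)
  show "nonzero_int_sums f s"
    by (rule assms)
next
  fix t assume "nonzero_int_sums f t"
  then show "t = s"
    using assms unfolding nonzero_int_sums_def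
    by (intro tendsto_unique[of "sequentially \<times>\<^sub>F sequentially"]) (simp_all add: prod_filter_eq_bot)
qed

section \<open>Evaluation on the lattice axis\<close>

lemma norm_x_axis: "norm (vector [x, 0, 0] :: real^3) = \<bar>x\<bar>"
  by (simp add: norm_vec_def L2_set_def sum_3)

lemma sph_harm_dir_x_axis:
  assumes "x \<noteq> 0"
  shows "sph_harm_dir s m (vector [x, 0, 0]) = sph_harm s m (pi / 2) (if x > 0 then 0 else pi)"
proof -
  have "inverse \<bar>x\<bar> * x = sgn x"
    using assms by (simp add: sgn_if)
  moreover have "Arg (Complex (sgn x) 0) = (if x > 0 then 0 else pi)"
    using assms by (simp add: Complex_eq)
  ultimately show ?thesis
    unfolding sph_harm_dir_def Let_def norm_x_axis by simp
qed

lemma sph_comp_x_axis: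
  assumes "q \<in> {-1, 0, 1}"
  shows "sph_comp (vector [- x, 0, 0]) (- q) = of_real (x * eps q)"
  using assms by (auto simp: sph_comp_def eps_def)

text \<open>Besides the factors of the summand that are free of the lattice vector, this takes \<open>eps q\<close>
  from the spherical component and the normalization from the irregular solid harmonic.\<close>

definition L_const :: "nat \<Rightarrow> nat \<Rightarrow> nat \<Rightarrow> int \<Rightarrow> int \<Rightarrow> int \<Rightarrow> int \<Rightarrow> complex" where
  "L_const l j lam m \<mu> q m1 =
      \<i> * (-1) powi (int lam + \<mu> + q) * of_int (sgn (q - m1)) * of_real (eps q)
      * of_real (sqrt (real lam * (2 * real l + 1)))
      * of_real (sqrt (int_binom (int l + int lam + \<mu> - m) (int lam + \<mu>)
                       * int_binom (int l + int lam + m - \<mu>) (int lam - \<mu>)))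
      * of_real (clebsch_gordan (lam - 1) (\<mu> - m1) 1 m1 lam \<mu>)
      * of_real (clebsch_gordan (lam - 1) (\<mu> - m1) 1 (q + m1) j (\<mu> + q))
      * of_real (sqrt (4 * pi / (2 * real (l + lam) + 1)))"

text \<open>The linear factor \<open>n\<close> of the spherical component lowers the order of decay by one, and it
  is the source of the opposite signs of the two halves of the series.\<close>

lemma L_term_eq:
  assumes "q \<in> {-1, 0, 1}" "n \<noteq> 0"
  shows "L_term l j lam m \<mu> q m1 \<alpha> n = L_const l j lam m \<mu> q m1
    * (of_int n / of_int \<bar>n\<bar> ^ Suc (l + lam) * exp (- (\<i> * of_int n * of_real \<alpha>))
       * sph_harm (l + lam) (m - \<mu>) (pi / 2) (if n > 0 then pi else 0))"
proof -
  have "irregular_solid_harm (l + lam) (m - \<mu>) (vector [- of_int n, 0, 0])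
    = of_real (sqrt (4 * pi / (2 * real (l + lam) + 1)))
      * sph_harm (l + lam) (m - \<mu>) (pi / 2) (if n > 0 then pi else 0)
      / of_int \<bar>n\<bar> ^ Suc (l + lam)"
    using assms(2) unfolding irregular_solid_harm_def
    by (subst sph_harm_dir_x_axis) (auto simp: norm_x_axis)
  moreover have "sph_comp (vector [- of_int n, 0, 0]) (- q) = of_int n * of_real (eps q)"
    using sph_comp_x_axis[OF assms(1), of "of_int n"] by simp
  ultimately show ?thesis
    unfolding L_term_def L_coeff_def L_const_def
    by (simp only:) (simp only: divide_inverse mult.assoc mult.commute mult.left_commute)
qed

lemma L_term_pos:
  assumes "q \<in> {-1, 0, 1}"
  shows "L_term l j lam m \<mu> q m1 \<alpha> (int (Suc k)) = L_const l j lam m \<mu> q m1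
    * (sph_harm (l + lam) (m - \<mu>) (pi / 2) pi
       * (exp (- (\<i> * of_real \<alpha>)) ^ Suc k / of_nat (Suc k) ^ (l + lam)))"
proof -
  have "exp (- (\<i> * of_nat (Suc k) * of_real \<alpha>)) = exp (- (\<i> * of_real \<alpha>)) ^ Suc k"
    unfolding exp_of_nat_mult[symmetric] by (simp add: algebra_simps)
  then show ?thesis
    by (subst L_term_eq[OF assms])
      (simp_all add: field_simps del: of_nat_Suc)
qed

lemma L_term_neg:
  assumes "q \<in> {-1, 0, 1}"
  shows "L_term l j lam m \<mu> q m1 \<alpha> (- int (Suc k)) = L_const l j lam m \<mu> q m1
    * (- sph_harm (l + lam) (m - \<mu>) (pi / 2) 0
       * (exp (\<i> * of_real \<alpha>) ^ Suc k / of_nat (Suc k) ^ (l + lam)))"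
proof -
  have "exp (\<i> * of_nat (Suc k) * of_real \<alpha>) = exp (\<i> * of_real \<alpha>) ^ Suc k"
    unfolding exp_of_nat_mult[symmetric] by (simp add: algebra_simps)
  then show ?thesis
    by (subst L_term_eq[OF assms])
      (simp_all add: field_simps del: of_nat_Suc)
qed

section \<open>The lattice series as a difference of polylogarithms\<close>

theorem lemma5p3:
  fixes l j lam :: nat and m \<mu> q m1 :: int and \<alpha> :: real
  assumes "lam \<ge> 1"
    and "\<bar>m\<bar> \<le> int l"
    and "\<bar>\<mu>\<bar> \<le> int lam"
    and "q \<in> {-1, 0, 1}"
    and "m1 \<in> {-1, 0, 1}"
    and "l + lam = 1 \<Longrightarrow> exp (\<i> * of_real \<alpha>) \<noteq> 1"
  shows "nonzero_int_sums (L_term l j lam m \<mu> q m1 \<alpha>) (L_series l j lam m \<mu> q m1 \<alpha>)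
    \<and> L_series l j lam m \<mu> q m1 \<alpha> =
      \<i> * (-1) powi (int lam + \<mu> + q) * of_int (sgn (q - m1)) * of_real (eps q)
      * of_real (sqrt (real lam * (2 * real l + 1)))
      * of_real (sqrt (int_binom (int l + int lam + \<mu> - m) (int lam + \<mu>)
                       * int_binom (int l + int lam + m - \<mu>) (int lam - \<mu>)))
      * of_real (clebsch_gordan (lam - 1) (\<mu> - m1) 1 m1 lam \<mu>)
      * of_real (clebsch_gordan (lam - 1) (\<mu> - m1) 1 (q + m1) j (\<mu> + q))
      * of_real (sqrt (4 * pi / (2 * real (l + lam) + 1)))
      * (polylog (l + lam) (exp (- (\<i> * of_real \<alpha>))) * sph_harm (l + lam) (m - \<mu>) (pi / 2) pi
         - polylog (l + lam) (exp (\<i> * of_real \<alpha>)) * sph_harm (l + lam) (m - \<mu>) (pi / 2) 0)"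
proof -
  define s where "s = l + lam"
  define z where "z = exp (\<i> * complex_of_real \<alpha>)"
  define z' where "z' = exp (- (\<i> * complex_of_real \<alpha>))"
  define Y0 where "Y0 = sph_harm s (m - \<mu>) (pi / 2) 0"
  define Y1 where "Y1 = sph_harm s (m - \<mu>) (pi / 2) pi"
  define C where "C = L_const l j lam m \<mu> q m1"
  have "s \<ge> 1"
    using assms(1) by (simp add: s_def)
  have "norm z = 1" "norm z' = 1"
    by (simp_all add: z_def z'_def)
  have "z' = inverse z"
    by (simp add: z_def z'_def exp_minus)
  have "z \<noteq> 1" "z' \<noteq> 1" if "s = 1"
    using that assms(6) unfolding \<open>z' = inverse z\<close> by (simp_all add: s_def z_def)
  then have "(\<lambda>k. z ^ Suc k / of_nat (Suc k) ^ s) sums polylog s z"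
    and "(\<lambda>k. z' ^ Suc k / of_nat (Suc k) ^ s) sums polylog s z'"
    using \<open>s \<ge> 1\<close> \<open>norm z = 1\<close> \<open>norm z' = 1\<close> by (intro polylog_sums; simp)+
  then have "(\<lambda>k. L_term l j lam m \<mu> q m1 \<alpha> (int (Suc k))) sums (C * (Y1 * polylog s z'))"
    and "(\<lambda>k. L_term l j lam m \<mu> q m1 \<alpha> (- int (Suc k))) sums (C * (- Y0 * polylog s z))"
    unfolding L_term_pos[OF assms(4)] L_term_neg[OF assms(4)]
    unfolding s_def z_def z'_def Y0_def Y1_def C_def
    by (intro sums_mult; simp only:)+
  then have "nonzero_int_sums (L_term l j lam m \<mu> q m1 \<alpha>)
      (C * (Y1 * polylog s z') + C * (- Y0 * polylog s z))"
    by (rule nonzero_int_sums_halves)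
  also have "C * (Y1 * polylog s z') + C * (- Y0 * polylog s z)
      = C * (polylog s z' * Y1 - polylog s z * Y0)"
    by (simp add: algebra_simps)
  finally have sums: "nonzero_int_sums (L_term l j lam m \<mu> q m1 \<alpha>)
      (C * (polylog s z' * Y1 - polylog s z * Y0))" .
  then have value_eq: "L_series l j lam m \<mu> q m1 \<alpha> = C * (polylog s z' * Y1 - polylog s z * Y0)"
    unfolding L_series_def by (rule nonzero_int_suminf_eqI)
  show ?thesis
    using sums value_eq unfolding value_eq
    by (simp only: C_def L_const_def s_def z_def z'_def Y0_def Y1_def)
qed

end
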